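(* Let $\Gamma_0=(N_0,v_0)$ be a non-negative game with $N_0=\{1,\dots,n\}$ and let $\Gamma_i=(N_i,v_i)$, $i\in N_0$, be normalized non-negative games. Then Owen's tensor composition is given by the total composition of the operad of cooperative games: $$\Gamma_0[\Gamma_1,\dots,\Gamma_n]=\gamma_{\mathbb G}(\Gamma_0;\Gamma_1,\dots,\Gamma_n).$$
   Context: A game is a pair $\Gamma=(N,v)$, $N$ a nonempty finite totally ordered set of players, $v:\mathcal P(N)\to\mathbb R$ with $v(\emptyset)=0$; it is non-negative if $v\ge0$ and normalized if $v(N)=1$. The player sets $N_1,\dots,N_n$ are pairwise disjoint. Owen's tensor composition $\Gamma_0[\Gamma_1,\dots,\Gamma_n]$ is the game on $N=N_1\cup\dots\cup N_n$ with $$v(S)=\sum_{T\subseteq N_0}\Big(\prod_{i\in T}v_i(S\cap N_i)\prod_{i\notin T}\big(1-v_i(S\cap N_i)\big)\Big)v_0(T),\qquad S\subseteq N.$$ Partial composition: for games $(A,\alpha)$, $(B,\beta)$ with disjoint player sets and $i\in A$, $(A,\alpha)\circ_i(B,\beta)$ has player set $A\diamond_iB=(A\setminus\{i\})\cup B$ ($B$ inserted in order in the place of $i$) and coalition function $$(\alpha\circ_i\beta)(S)=\beta(B)\alpha(S\cap A)+\partial_i\alpha(S\cap A)\,\beta(S\cap B),\qquad \partial_i\alpha(T)=\alpha(T\cup\{i\})-\alpha(T\setminus\{i\}).$$ These form an operad $\mathbb G$; its total composition $\gamma_{\mathbb G}(\Gamma_0;\Gamma_1,\dots,\Gamma_n)$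 is the game obtained by successively replacing each player $i\in N_0$ by $\Gamma_i$ through partial composition, i.e. $(\cdots((\Gamma_0\circ_n\Gamma_n)\circ_{n-1}\Gamma_{n-1})\cdots)\circ_1\Gamma_1$, where $\circ_i$ is taken at the original player $i$ of $N_0$ (the order of insertion does not matter). *)

theory Defs
  imports Complex_Main "HOL-Library.FuncSet" "HOL-Library.Disjoint_Sets"
begin

text \<open>
  The field \<open>player_order\<close> is the (reflexive) total order on the set of players.  A coalition
  function is only meaningful on the subsets of the player set; it is taken to be
  extensional there, so that HOL equality of records is equality of games.
\<close>

record 'a game =
  players :: "'a set"
  player_order :: "'a rel"
  worth :: "'a set \<Rightarrow> real"

definition is_game :: "'a game \<Rightarrow> bool" where
  "is_game G \<longleftrightarrow>
     finite (players G) \<and> players G \<noteq> {} \<and>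
     linear_order_on (players G) (player_order G) \<and>
     worth G \<in> extensional (Pow (players G)) \<and>
     worth G {} = 0"

definition nonnegative :: "'a game \<Rightarrow> bool" where
  "nonnegative G \<longleftrightarrow> (\<forall>S\<subseteq>players G. 0 \<le> worth G S)"

definition normalized :: "'a game \<Rightarrow> bool" where
  "normalized G \<longleftrightarrow> worth G (players G) = 1"

text \<open>
  The player set of the tensor composition carries the ordered-sum order: the blocks
  \<open>players (G i)\<close> follow each other in the order of the players \<open>i\<close> of \<open>G0\<close>.
\<close>

definition owen_order :: "'p game \<Rightarrow> ('p \<Rightarrow> 'a game) \<Rightarrow> 'a rel" where
  "owen_order G0 G =
     (\<Union>i\<in>players G0. player_order (G i)) \<union>
     {(x, y). \<exists>i j. (i, j) \<in> player_order G0 \<and> i \<noteq> j \<and>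
                    x \<in> players (G i) \<and> y \<in> players (G j)}"

definition owen_tensor :: "'p game \<Rightarrow> ('p \<Rightarrow> 'a game) \<Rightarrow> 'a game" where
  "owen_tensor G0 G =
     \<lparr> players = (\<Union>i\<in>players G0. players (G i)),
       player_order = owen_order G0 G,
       worth = (\<lambda>S \<in> Pow (\<Union>i\<in>players G0. players (G i)).
         \<Sum>T\<in>Pow (players G0).
           ((\<Prod>i\<in>T. worth (G i) (S \<inter> players (G i))) *
            (\<Prod>i\<in>players G0 - T. 1 - worth (G i) (S \<inter> players (G i)))) * worth G0 T) \<rparr>"

definition marginal :: "'a \<Rightarrow> ('a set \<Rightarrow> real) \<Rightarrow> 'a set \<Rightarrow> real" where
  "marginal i v T = v (T \<union> {i}) - v (T - {i})"

definition insertion_order :: "'a game \<Rightarrow> 'a \<Rightarrow> 'a game \<Rightarrow> 'a rel" where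
  "insertion_order G i H =
     {(x, y) \<in> player_order G. x \<noteq> i \<and> y \<noteq> i} \<union>
     player_order H \<union>
     {(x, y). x \<noteq> i \<and> (x, i) \<in> player_order G \<and> y \<in> players H} \<union>
     {(x, y). x \<in> players H \<and> y \<noteq> i \<and> (i, y) \<in> player_order G}"

text \<open>Meaningful when \<open>i\<close> is a player of \<open>G\<close> and the player sets of \<open>G\<close> and \<open>H\<close> are disjoint.\<close>

definition partial_comp :: "'a game \<Rightarrow> 'a \<Rightarrow> 'a game \<Rightarrow> 'a game" where
  "partial_comp G i H =
     \<lparr> players = (players G - {i}) \<union> players H,
       player_order = insertion_order G i H,
       worth = (\<lambda>S \<in> Pow ((players G - {i}) \<union> players H).
         worth H (players H) * worth G (S \<inter> players G) +
         marginal i (worth G) (S \<inter> players G) * worth H (S \<inter> players H)) \<rparr>"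

text \<open>Transport of a game along a map that is injective on its players.\<close>

definition relabel :: "('a \<Rightarrow> 'b) \<Rightarrow> 'a game \<Rightarrow> 'b game" where
  "relabel f G =
     \<lparr> players = f ` players G,
       player_order = map_prod f f ` player_order G,
       worth = (\<lambda>S \<in> Pow (f ` players G). worth G {x \<in> players G. f x \<in> S}) \<rparr>"

text \<open>
  Partial composition needs disjoint player sets inside one type.  The players \<open>1, \<dots>, n\<close> of
  \<open>G0\<close> are therefore tagged with \<open>Inl\<close> and those of the inserted games with \<open>Inr\<close>.  Once all
  of \<open>1, \<dots>, n\<close> have been replaced, only \<open>Inr\<close> players remain and the tag is removed.
  Since \<open>foldr\<close> works from the right, player \<open>n\<close> is replaced first and player \<open>1\<close> last.
\<close>

definition total_comp :: "nat \<Rightarrow> nat game \<Rightarrow> (nat \<Rightarrow> 'a game) \<Rightarrow> 'a game" where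
  "total_comp n G0 G =
     relabel projr
       (foldr (\<lambda>i K. partial_comp K (Inl i) (relabel Inr (G i))) [1..<Suc n] (relabel Inl G0))"

end

theory Submission
  imports Defs
begin

text \<open>
  The worth of a coalition in Owen's tensor composition is the multilinear extension of \<open>v\<^sub>0\<close>
  evaluated at the vector of block worths.  A multilinear function is affine in each coordinate,
  \<open>E(t) = (1 - t) E(0) + t E(1)\<close>, and for a normalized inserted game this is literally the formula
  for partial composition: inserting \<open>\<beta>\<close> in the place of \<open>i \<notin> S\<close> gives, with the restrictions of
  \<open>S\<close> to the two player sets suppressed, \<open>\<alpha>(S) + (\<alpha>(S \<union> {i}) - \<alpha>(S)) \<beta>(S)\<close>.

  To exploit this, every intermediate stage of the total composition is itself written as a tensor
  composition over \<open>\<Gamma>\<^sub>0\<close>, in which a player that has not been replaced yet counts as a block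
  holding the one-player game of worth 1 (lemma \<open>foldr_partial_comp\<close>).  With only such blocks the
  tensor composition is a relabelled \<open>\<Gamma>\<^sub>0\<close>, because the multilinear extension agrees with \<open>v\<^sub>0\<close> at the
  vertices of the cube (lemma \<open>owen_tensor_singleton_games\<close>).  Each partial composition exchanges
  one of these blocks for the inserted game (lemma \<open>partial_comp_owen_tensor\<close>).  The orders fit as
  well: inserting a block in the place of a player of an ordered sum of blocks is again an ordered
  sum.
\<close>

section \<open>The multilinear extension\<close>

definition multilinear_ext :: "'p set \<Rightarrow> ('p set \<Rightarrow> real) \<Rightarrow> ('p \<Rightarrow> real) \<Rightarrow> real" where
  "multilinear_ext P v w = (\<Sum>T\<in>Pow P. ((\<Prod>i\<in>T. w i) * (\<Prod>i\<in>P - T. 1 - w i)) * v T)"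

lemma multilinear_ext_cong:
  assumes "\<And>i. i \<in> P \<Longrightarrow> w i = w' i"
  shows "multilinear_ext P v w = multilinear_ext P v w'"
proof -
  have "(\<Prod>i\<in>T. w i) = (\<Prod>i\<in>T. w' i)" "(\<Prod>i\<in>P - T. 1 - w i) = (\<Prod>i\<in>P - T. 1 - w' i)"
    if "T \<subseteq> P" for T
    using that assms by (auto intro!: prod.cong)
  then show ?thesis
    by (auto simp: multilinear_ext_def intro!: sum.cong)
qed

text \<open>
  In each summand coordinate \<open>i\<close> occurs in exactly one factor: as \<open>w i\<close> if \<open>i \<in> T\<close>, as
  \<open>1 - w i\<close> otherwise.
\<close>

lemma multilinear_ext_affine:
  assumes "finite P" "i \<in> P"
  shows "multilinear_ext P v w =
    (1 - w i) * multilinear_ext P v (w(i := 0)) + w i * multilinear_ext P v (w(i := 1))"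
proof -
  define c where "c u T = (\<Prod>j\<in>T. u j) * (\<Prod>j\<in>P - T. 1 - u j)" for u :: "'a \<Rightarrow> real" and T
  have c: "c w T = (1 - w i) * c (w(i := 0)) T + w i * c (w(i := 1)) T" if T: "T \<subseteq> P" for T
  proof (cases "i \<in> T")
    case True
    have *: "c u T = u i * ((\<Prod>j\<in>T - {i}. u j) * (\<Prod>j\<in>P - T. 1 - u j))" for u
      using True T assms(1) by (simp add: c_def prod.remove finite_subset)
    have "(\<Prod>j\<in>T - {i}. (w(i := t)) j) = (\<Prod>j\<in>T - {i}. w j)"
         "(\<Prod>j\<in>P - T. 1 - (w(i := t)) j) = (\<Prod>j\<in>P - T. 1 - w j)" for t
      using True by (auto intro!: prod.cong)
    then show ?thesis by (simp only: *) simp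
  next
    case False
    have *: "c u T = (1 - u i) * ((\<Prod>j\<in>T. u j) * (\<Prod>j\<in>P - T - {i}. 1 - u j))" for u
      using False assms by (simp add: c_def prod.remove[of "P - T" i])
    have "(\<Prod>j\<in>T. (w(i := t)) j) = (\<Prod>j\<in>T. w j)"
         "(\<Prod>j\<in>P - T - {i}. 1 - (w(i := t)) j) = (\<Prod>j\<in>P - T - {i}. 1 - w j)" for t
      using False by (auto intro!: prod.cong)
    then show ?thesis by (simp only: *) simp
  qed
  have "(\<Sum>T\<in>Pow P. c w T * v T) =
      (\<Sum>T\<in>Pow P. (1 - w i) * (c (w(i := 0)) T * v T) + w i * (c (w(i := 1)) T * v T))"
    by (rule sum.cong) (simp_all add: c algebra_simps)
  also have "\<dots> = (1 - w i) * (\<Sum>T\<in>Pow P. c (w(i := 0)) T * v T)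
      + w i * (\<Sum>T\<in>Pow P. c (w(i := 1)) T * v T)"
    by (simp add: sum.distrib sum_distrib_left)
  finally show ?thesis
    by (simp only: multilinear_ext_def c_def)
qed

text \<open>
  At a vertex of the cube only the summand of that vertex survives: any other coalition either
  contains a player of weight 0 or omits one of weight 1.
\<close>

lemma multilinear_ext_vertex:
  assumes "finite P"
  shows "multilinear_ext P v (\<lambda>i. if Q i then 1 else 0) = v {i \<in> P. Q i}"
proof -
  define A where "A = {i \<in> P. Q i}"
  define c where "c T = (\<Prod>i\<in>T. if Q i then 1 else 0) * (\<Prod>i\<in>P - T. 1 - (if Q i then 1 else 0 :: real))"
    for T
  have "c T = (if T = A then 1 else 0)" if T: "T \<subseteq> P" for T
  proof (cases "T = A")
    case True
    then show ?thesis by (auto simp: c_def A_def intro!: prod.neutral)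
  next
    case False
    then consider i where "i \<in> T" "\<not> Q i" | i where "i \<in> P - T" "Q i"
      using T by (auto simp: A_def)
    then show ?thesis
    proof cases
      case 1
      then have "(\<Prod>i\<in>T. if Q i then 1 else 0 :: real) = 0"
        using T assms by (intro prod_zero) (auto intro: finite_subset)
      then show ?thesis using False by (simp add: c_def)
    next
      case 2
      then have "(\<Prod>i\<in>P - T. 1 - (if Q i then 1 else 0 :: real)) = 0"
        using assms by (intro prod_zero) auto
      then show ?thesis using False by (simp add: c_def)
    qed
  qed
  then have "(\<Sum>T\<in>Pow P. c T * v T) = (\<Sum>T\<in>Pow P. if T = A then v T else 0)"
    by (intro sum.cong) auto
  also have "\<dots> = v A"
    using assms by (subst sum.delta) (auto simp: A_def)
  finally show ?thesis
    by (simp add: multilinear_ext_def c_def A_def)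
qed

lemma worth_owen_tensor:
  assumes "S \<subseteq> players (owen_tensor G0 H)"
  shows "worth (owen_tensor G0 H) S =
    multilinear_ext (players G0) (worth G0) (\<lambda>i. worth (H i) (S \<inter> players (H i)))"
  using assms by (simp add: owen_tensor_def multilinear_ext_def)

lemma worth_owen_tensor_outside:
  assumes "\<not> S \<subseteq> players (owen_tensor G0 H)"
  shows "worth (owen_tensor G0 H) S = undefined"
  using assms by (simp add: owen_tensor_def)

lemma owen_tensor_cong:
  assumes "player_order G0 \<subseteq> players G0 \<times> players G0"
    and H: "\<And>i. i \<in> players G0 \<Longrightarrow> H i = H' i"
  shows "owen_tensor G0 H = owen_tensor G0 H'"
proof -
  have N: "(\<Union>i\<in>players G0. players (H i)) = (\<Union>i\<in>players G0. players (H' i))"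
    using H by auto
  have ord: "owen_order G0 H = owen_order G0 H'"
  proof -
    have "(\<exists>i j. (i, j) \<in> player_order G0 \<and> i \<noteq> j \<and> x \<in> players (H i) \<and> y \<in> players (H j)) \<longleftrightarrow>
        (\<exists>i j. (i, j) \<in> player_order G0 \<and> i \<noteq> j \<and> x \<in> players (H' i) \<and> y \<in> players (H' j))" for x y
      using assms by (metis (no_types, lifting) mem_Sigma_iff subsetD)
    then show ?thesis
      using H by (simp add: owen_order_def)
  qed
  have "multilinear_ext (players G0) (worth G0) (\<lambda>i. worth (H i) (S \<inter> players (H i))) =
      multilinear_ext (players G0) (worth G0) (\<lambda>i. worth (H' i) (S \<inter> players (H' i)))" for S
    by (rule multilinear_ext_cong) (simp add: H)
  then show ?thesis
    by (simp only: owen_tensor_def N ord multilinear_ext_def)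
qed

section \<open>Relabelling\<close>

lemma is_game_order:
  assumes "is_game G"
  shows "player_order G \<subseteq> players G \<times> players G" and "refl_on (players G) (player_order G)"
  using assms
  by (auto simp: is_game_def linear_order_on_def partial_order_on_def preorder_on_def)

lemma relabel_relabel: "relabel g (relabel f G) = relabel (g \<circ> f) G"
proof -
  have *: "{x \<in> players G. f x \<in> f ` players G \<and> g (f x) \<in> S} = {x \<in> players G. g (f x) \<in> S}" for S
    by auto
  show ?thesis
    by (simp add: relabel_def image_comp prod.map_comp * restrict_def fun_eq_iff)
qed

lemma relabel_id:
  assumes "is_game G"
  shows "relabel id G = G"
proof -
  have "worth G {x \<in> players G. x \<in> S} = worth G S" if "S \<subseteq> players G" for S
    using that by (metis Int_absorb2 Collect_conj_eq Collect_mem_eq Int_absorb1)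
  moreover have "worth G S = undefined" if "\<not> S \<subseteq> players G" for S
    using assms that by (auto simp: is_game_def extensional_def)
  ultimately have "(\<lambda>S \<in> Pow (players G). worth G {x \<in> players G. x \<in> S}) = worth G"
    by (auto simp: fun_eq_iff)
  then show ?thesis
    by (simp add: relabel_def map_prod.id)
qed

lemma normalized_relabel:
  "normalized (relabel f G) \<longleftrightarrow> normalized G"
proof -
  have "{x \<in> players G. f x \<in> f ` players G} = players G" by auto
  then show ?thesis by (simp add: normalized_def relabel_def)
qed

text \<open>
  Taking preimages of coalitions commutes with restricting them to a block, so both sides
  evaluate the multilinear extension at the same block worths.  Blocks that the map makes overlap do
  no harm, since the tensor composition looks at each block separately.
\<close>

lemma relabel_owen_tensor: "relabel f (owen_tensor G0 H) = owen_tensor G0 (\<lambda>i. relabel f (H i))"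
proof (rule game.equality)
  show pl: "players (relabel f (owen_tensor G0 H)) = players (owen_tensor G0 (\<lambda>i. relabel f (H i)))"
    by (simp add: relabel_def owen_tensor_def image_UN)
  show "player_order (relabel f (owen_tensor G0 H)) =
      player_order (owen_tensor G0 (\<lambda>i. relabel f (H i)))"
  proof -
    let ?R = "player_order G0"
    have "map_prod f f ` {(x, y). \<exists>i j. (i, j) \<in> ?R \<and> i \<noteq> j \<and> x \<in> players (H i) \<and> y \<in> players (H j)} =
        {(x, y). \<exists>i j. (i, j) \<in> ?R \<and> i \<noteq> j \<and> x \<in> f ` players (H i) \<and> y \<in> f ` players (H j)}"
      by (auto intro!: rev_image_eqI)
    then show ?thesis
      by (simp add: relabel_def owen_tensor_def owen_order_def image_Un image_UN)
  qed
  show "worth (relabel f (owen_tensor G0 H)) = worth (owen_tensor G0 (\<lambda>i. relabel f (H i)))"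
  proof
    fix S
    let ?N = "players (owen_tensor G0 H)"
    show "worth (relabel f (owen_tensor G0 H)) S = worth (owen_tensor G0 (\<lambda>i. relabel f (H i))) S"
    proof (cases "S \<subseteq> f ` ?N")
      case True
      have "worth (relabel f (owen_tensor G0 H)) S = worth (owen_tensor G0 H) {x \<in> ?N. f x \<in> S}"
        using True by (simp add: relabel_def)
      also have "\<dots> = multilinear_ext (players G0) (worth G0)
          (\<lambda>i. worth (H i) ({x \<in> ?N. f x \<in> S} \<inter> players (H i)))"
        by (rule worth_owen_tensor) auto
      also have "\<dots> = multilinear_ext (players G0) (worth G0)
          (\<lambda>i. worth (relabel f (H i)) (S \<inter> players (relabel f (H i))))"
      proof (rule multilinear_ext_cong)
        fix i assume "i \<in> players G0"
        then have "{x \<in> ?N. f x \<in> S} \<inter> players (H i) =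
            {x \<in> players (H i). f x \<in> S \<inter> f ` players (H i)}"
          by (auto simp: owen_tensor_def)
        then show "worth (H i) ({x \<in> ?N. f x \<in> S} \<inter> players (H i)) =
            worth (relabel f (H i)) (S \<inter> players (relabel f (H i)))"
          by (simp add: relabel_def)
      qed
      also have "\<dots> = worth (owen_tensor G0 (\<lambda>i. relabel f (H i))) S"
        using True pl by (intro worth_owen_tensor[symmetric]) (simp add: relabel_def)
      finally show ?thesis .
    next
      case False
      then have "\<not> S \<subseteq> players (owen_tensor G0 (\<lambda>i. relabel f (H i)))"
        using pl by (simp add: relabel_def)
      then show ?thesis
        using False by (simp add: worth_owen_tensor_outside) (simp add: relabel_def)
    qed
  qed
qed simp

section \<open>Replacing players one by one\<close>

definition singleton_game :: "'a \<Rightarrow> 'a game" where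
  "singleton_game p =
     \<lparr> players = {p}, player_order = {(p, p)},
       worth = (\<lambda>S \<in> Pow {p}. if p \<in> S then 1 else 0) \<rparr>"

lemma players_singleton_game [simp]: "players (singleton_game p) = {p}"
  and player_order_singleton_game [simp]: "player_order (singleton_game p) = {(p, p)}"
  and worth_singleton_game [simp]:
    "S \<subseteq> {p} \<Longrightarrow> worth (singleton_game p) S = (if p \<in> S then 1 else 0)"
  by (simp_all add: singleton_game_def)

lemma owen_tensor_singleton_games:
  assumes "is_game G0"
  shows "owen_tensor G0 (\<lambda>i. singleton_game (f i)) = relabel f G0"
proof (rule game.equality)
  show pl: "players (owen_tensor G0 (\<lambda>i. singleton_game (f i))) = players (relabel f G0)"
    by (auto simp: owen_tensor_def relabel_def)
  show "player_order (owen_tensor G0 (\<lambda>i. singleton_game (f i))) = player_order (relabel f G0)"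
    using is_game_order[OF assms]
    by (force simp: owen_tensor_def owen_order_def relabel_def image_iff refl_on_def)
  show "worth (owen_tensor G0 (\<lambda>i. singleton_game (f i))) = worth (relabel f G0)"
  proof
    fix S
    show "worth (owen_tensor G0 (\<lambda>i. singleton_game (f i))) S = worth (relabel f G0) S"
    proof (cases "S \<subseteq> players (relabel f G0)")
      case True
      then have "worth (owen_tensor G0 (\<lambda>i. singleton_game (f i))) S =
          multilinear_ext (players G0) (worth G0) (\<lambda>i. if f i \<in> S then 1 else 0)"
        by (simp add: pl worth_owen_tensor)
      also have "\<dots> = worth G0 {i \<in> players G0. f i \<in> S}"
        using assms by (intro multilinear_ext_vertex) (simp add: is_game_def)
      finally show ?thesis using True by (simp add: relabel_def)
    next
      case False
      then show ?thesis
        using worth_owen_tensor_outside[of S G0 "\<lambda>i. singleton_game (f i)"] pl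
        by (auto simp: relabel_def)
    qed
  qed
qed simp

text \<open>
  With the block of \<open>i\<close> reduced to a single player \<open>p\<close> of worth 1, a coalition with or without
  \<open>p\<close> gives coordinate \<open>i\<close> the value 1 or 0.  So the marginal at \<open>p\<close> is the slope of the
  multilinear extension in coordinate \<open>i\<close>, and partial composition moves that coordinate to the
  worth of the inserted game.
\<close>

lemma partial_comp_owen_tensor:
  assumes "finite (players G0)" and ord0: "player_order G0 \<subseteq> players G0 \<times> players G0"
    and i: "i \<in> players G0" and Hi: "H i = singleton_game p"
    and p: "\<And>k. k \<in> players G0 \<Longrightarrow> k \<noteq> i \<Longrightarrow> p \<notin> players (H k)"
    and ordH: "\<And>k. k \<in> players G0 \<Longrightarrow> player_order (H k) \<subseteq> players (H k) \<times> players (H k)"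
    and C: "normalized C" "p \<notin> players C"
  shows "partial_comp (owen_tensor G0 H) p C = owen_tensor G0 (H(i := C))"
proof (rule game.equality)
  show pl: "players (partial_comp (owen_tensor G0 H) p C) = players (owen_tensor G0 (H(i := C)))"
  proof -
    define U where "U = (\<Union>k\<in>players G0 - {i}. players (H k))"
    have "(\<Union>k\<in>players G0. players (H k)) = players (H i) \<union> U"
      using i by (auto simp: U_def)
    moreover have "(\<Union>k\<in>players G0. players ((H(i := C)) k)) = players C \<union> U"
      using i by (auto simp: U_def split: if_splits)
    moreover have "p \<notin> U"
      using p by (auto simp: U_def)
    ultimately show ?thesis
      by (auto simp: partial_comp_def owen_tensor_def Hi)
  qed
  show "player_order (partial_comp (owen_tensor G0 H) p C) =
      player_order (owen_tensor G0 (H(i := C)))"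
  proof -
    let ?P = "players G0" and ?R = "player_order G0"
    let ?L = "owen_order G0 H"
    have owen_H: "(x, y) \<in> ?L \<longleftrightarrow>
        (\<exists>k\<in>?P. (x, y) \<in> player_order (H k)) \<or>
        (\<exists>a b. (a, b) \<in> ?R \<and> a \<noteq> b \<and> x \<in> players (H a) \<and> y \<in> players (H b))" for x y
      by (auto simp: owen_order_def)
    have block: "k = i" if "k \<in> ?P" "p \<in> players (H k)" for k
      using that p by blast
    have RP: "a \<in> ?P" "b \<in> ?P" if "(a, b) \<in> ?R" for a b
      using that ord0 by auto
    have ordHk: "x \<in> players (H k)" "y \<in> players (H k)"
      if "k \<in> ?P" "(x, y) \<in> player_order (H k)" for k x y
      using that ordH by auto
    (* The three ways in which insertion into the ordered sum uses its order: between players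
       other than p, below p and above p.  Each is traced back to the order of the blocks. *)
    have inner: "(x, y) \<in> ?L \<and> x \<noteq> p \<and> y \<noteq> p \<longleftrightarrow>
        (\<exists>k\<in>?P - {i}. (x, y) \<in> player_order (H k)) \<or>
        (\<exists>a b. (a, b) \<in> ?R \<and> a \<noteq> b \<and> a \<noteq> i \<and> b \<noteq> i \<and>
           x \<in> players (H a) \<and> y \<in> players (H b))" (is "?l \<longleftrightarrow> ?r") for x y
    proof
      assume ?l
      then consider k where "k \<in> ?P" "(x, y) \<in> player_order (H k)" "x \<noteq> p"
        | a b where "(a, b) \<in> ?R" "a \<noteq> b" "x \<in> players (H a)" "y \<in> players (H b)" "x \<noteq> p" "y \<noteq> p"
        unfolding owen_H by blast
      then show ?r
      proof cases
        case 1
        then have "k \<noteq> i" using Hi by auto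
        with 1 show ?thesis by blast
      next
        case 2
        then have "a \<noteq> i" "b \<noteq> i" using Hi by auto
        with 2 show ?thesis by blast
      qed
    next
      assume ?r
      then consider k where "k \<in> ?P" "k \<noteq> i" "(x, y) \<in> player_order (H k)"
        | a b where "(a, b) \<in> ?R" "a \<noteq> b" "a \<noteq> i" "b \<noteq> i" "x \<in> players (H a)" "y \<in> players (H b)"
        by blast
      then show ?l
      proof cases
        case 1
        then have "x \<noteq> p" "y \<noteq> p" using ordHk[of k x y] p[of k] by auto
        with 1 show ?thesis unfolding owen_H by blast
      next
        case 2
        then have "x \<noteq> p" "y \<noteq> p" using RP[of a b] p[of a] p[of b] by auto
        with 2 show ?thesis unfolding owen_H by blast
      qed
    qed
    have below: "x \<noteq> p \<and> (x, p) \<in> ?L \<longleftrightarrow> (\<exists>a. (a, i) \<in> ?R \<and> a \<noteq> i \<and> x \<in> players (H a))"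
      (is "?l \<longleftrightarrow> ?r") for x
    proof
      assume l: ?l
      have "(x, p) \<notin> player_order (H k)" if "k \<in> ?P" for k
        using that l block[of k] ordHk[of k x p] Hi by auto
      with l obtain a b where ab: "(a, b) \<in> ?R" "a \<noteq> b" "x \<in> players (H a)" "p \<in> players (H b)"
        unfolding owen_H by blast
      then have "b = i" using RP[of a b] block[of b] by simp
      with ab show ?r by auto
    next
      assume ?r
      then obtain a where a: "(a, i) \<in> ?R" "a \<noteq> i" "x \<in> players (H a)" by blast
      then have "x \<noteq> p" using RP[of a i] p[of a] by auto
      moreover have "p \<in> players (H i)" using Hi by simp
      ultimately show ?l unfolding owen_H using a by metis
    qed
    have above: "y \<noteq> p \<and> (p, y) \<in> ?L \<longleftrightarrow> (\<exists>b. (i, b) \<in> ?R \<and> b \<noteq> i \<and> y \<in> players (H b))"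
      (is "?l \<longleftrightarrow> ?r") for y
    proof
      assume l: ?l
      have "(p, y) \<notin> player_order (H k)" if "k \<in> ?P" for k
        using that l block[of k] ordHk[of k p y] Hi by auto
      with l obtain a b where ab: "(a, b) \<in> ?R" "a \<noteq> b" "p \<in> players (H a)" "y \<in> players (H b)"
        unfolding owen_H by blast
      then have "a = i" using RP[of a b] block[of a] by simp
      with ab show ?r by auto
    next
      assume ?r
      then obtain b where b: "(i, b) \<in> ?R" "b \<noteq> i" "y \<in> players (H b)" by blast
      then have "y \<noteq> p" using RP[of i b] p[of b] by auto
      moreover have "p \<in> players (H i)" using Hi by simp
      ultimately show ?l unfolding owen_H using b by metis
    qed
    have "(x, y) \<in> insertion_order (owen_tensor G0 H) p C \<longleftrightarrow> (x, y) \<in> owen_order G0 (H(i := C))"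
      for x y
    proof -
      have "(x, y) \<in> insertion_order (owen_tensor G0 H) p C \<longleftrightarrow>
          ((x, y) \<in> ?L \<and> x \<noteq> p \<and> y \<noteq> p) \<or> (x, y) \<in> player_order C \<or>
          ((x \<noteq> p \<and> (x, p) \<in> ?L) \<and> y \<in> players C) \<or>
          (x \<in> players C \<and> (y \<noteq> p \<and> (p, y) \<in> ?L))"
        by (auto simp: insertion_order_def owen_tensor_def)
      also have "\<dots> \<longleftrightarrow> (x, y) \<in> owen_order G0 (H(i := C))"
      proof -
        let ?H' = "H(i := C)"
        define Q where
          "Q a b \<longleftrightarrow> (a, b) \<in> ?R \<and> a \<noteq> b \<and> x \<in> players (?H' a) \<and> y \<in> players (?H' b)" for a b
        have within: "(\<exists>k\<in>?P. (x, y) \<in> player_order (?H' k)) \<longleftrightarrow>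
            (x, y) \<in> player_order C \<or> (\<exists>k\<in>?P - {i}. (x, y) \<in> player_order (H k))"
          using i by auto
        have "\<not> Q i i" by (simp add: Q_def)
        then have "(\<exists>a b. Q a b) \<longleftrightarrow>
            (\<exists>a b. a \<noteq> i \<and> b \<noteq> i \<and> Q a b) \<or> (\<exists>a. a \<noteq> i \<and> Q a i) \<or> (\<exists>b. b \<noteq> i \<and> Q i b)"
          by metis
        moreover have "(\<exists>a b. a \<noteq> i \<and> b \<noteq> i \<and> Q a b) \<longleftrightarrow>
            (\<exists>a b. (a, b) \<in> ?R \<and> a \<noteq> b \<and> a \<noteq> i \<and> b \<noteq> i \<and>
               x \<in> players (H a) \<and> y \<in> players (H b))"
          unfolding Q_def by (intro ex_cong1) auto
        moreover have "(\<exists>a. a \<noteq> i \<and> Q a i) \<longleftrightarrow>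
            (\<exists>a. (a, i) \<in> ?R \<and> a \<noteq> i \<and> x \<in> players (H a)) \<and> y \<in> players C"
          unfolding Q_def by auto
        moreover have "(\<exists>b. b \<noteq> i \<and> Q i b) \<longleftrightarrow>
            x \<in> players C \<and> (\<exists>b. (i, b) \<in> ?R \<and> b \<noteq> i \<and> y \<in> players (H b))"
          unfolding Q_def by auto
        moreover have "(x, y) \<in> owen_order G0 ?H' \<longleftrightarrow>
            (\<exists>k\<in>?P. (x, y) \<in> player_order (?H' k)) \<or> (\<exists>a b. Q a b)"
          by (simp add: owen_order_def Q_def)
        ultimately show ?thesis
          unfolding inner below above using within by argo
      qed
      finally show ?thesis .
    qed
    then show ?thesis
      by (auto simp: partial_comp_def) (auto simp: owen_tensor_def)
  qed
  show "worth (partial_comp (owen_tensor G0 H) p C) = worth (owen_tensor G0 (H(i := C)))"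
  proof
    fix S
    show "worth (partial_comp (owen_tensor G0 H) p C) S = worth (owen_tensor G0 (H(i := C))) S"
    proof (cases "S \<subseteq> players (owen_tensor G0 (H(i := C)))")
      case True
      let ?N = "players (owen_tensor G0 H)" and ?E = "multilinear_ext (players G0) (worth G0)"
      define w where "w = (\<lambda>k. worth ((H(i := C)) k) (S \<inter> players ((H(i := C)) k)))"
      have N: "players (H k) \<subseteq> ?N" if "k \<in> players G0" for k
        using that by (auto simp: owen_tensor_def)
      have pN: "p \<in> ?N" using N[OF i] Hi by simp
      have pS: "p \<notin> S"
        using True p C(2) by (auto simp: owen_tensor_def split: if_splits)
      have with_p: "worth (owen_tensor G0 H) (S \<inter> ?N \<union> {p}) = ?E (w(i := 1))"
      proof (subst worth_owen_tensor)
        show "S \<inter> ?N \<union> {p} \<subseteq> ?N" using pN by auto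
        have "worth (H k) ((S \<inter> ?N \<union> {p}) \<inter> players (H k)) = (w(i := 1)) k"
          if k: "k \<in> players G0" for k
        proof (cases "k = i")
          case False
          then have "(S \<inter> ?N \<union> {p}) \<inter> players (H k) = S \<inter> players (H k)"
            using p[OF k] N[OF k] by auto
          with False show ?thesis by (simp add: w_def)
        next
          case True
          then show ?thesis by (simp add: Hi)
        qed
        then show "?E (\<lambda>k. worth (H k) ((S \<inter> ?N \<union> {p}) \<inter> players (H k))) = ?E (w(i := 1))"
          by (rule multilinear_ext_cong)
      qed
      have without_p: "worth (owen_tensor G0 H) (S \<inter> ?N) = ?E (w(i := 0))"
      proof (subst worth_owen_tensor)
        have "worth (H k) ((S \<inter> ?N) \<inter> players (H k)) = (w(i := 0)) k" if k: "k \<in> players G0" for k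
        proof (cases "k = i")
          case False
          then have "(S \<inter> ?N) \<inter> players (H k) = S \<inter> players (H k)"
            using N[OF k] by auto
          with False show ?thesis by (simp add: w_def)
        next
          case True
          then show ?thesis using pS by (simp add: Hi)
        qed
        then show "?E (\<lambda>k. worth (H k) (S \<inter> ?N \<inter> players (H k))) = ?E (w(i := 0))"
          by (rule multilinear_ext_cong)
      qed auto
      have "S \<inter> ?N - {p} = S \<inter> ?N" using pS by auto
      then have "worth (partial_comp (owen_tensor G0 H) p C) S =
          ?E (w(i := 0)) + (?E (w(i := 1)) - ?E (w(i := 0))) * w i"
        using True pl C(1) with_p without_p
        by (simp add: partial_comp_def marginal_def normalized_def w_def)
      also have "\<dots> = (1 - w i) * ?E (w(i := 0)) + w i * ?E (w(i := 1))"
        by (simp add: algebra_simps)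
      also have "\<dots> = ?E w"
        using assms(1) i by (rule multilinear_ext_affine[symmetric])
      also have "\<dots> = worth (owen_tensor G0 (H(i := C))) S"
        unfolding w_def by (rule worth_owen_tensor[OF True, symmetric])
      finally show ?thesis .
    next
      case False
      then have "worth (partial_comp (owen_tensor G0 H) p C) S = undefined"
        using pl by (simp add: partial_comp_def)
      then show ?thesis using worth_owen_tensor_outside[OF False] by simp
    qed
  qed
qed simp

text \<open>
  The invariant of the total composition.  The tags \<open>Inl\<close> and \<open>Inr\<close> keep the players still to be
  replaced apart from all inserted ones, so every step has the form of the preceding lemma,
  whatever the order of the insertions.
\<close>

lemma foldr_partial_comp:
  assumes G0: "is_game G0"
    and G: "\<And>i. i \<in> players G0 \<Longrightarrow> is_game (G i) \<and> normalized (G i)"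
    and "distinct xs" "set xs \<subseteq> players G0"
  shows "foldr (\<lambda>i K. partial_comp K (Inl i) (relabel Inr (G i))) xs (relabel Inl G0) =
    owen_tensor G0 (\<lambda>i. if i \<in> set xs then relabel Inr (G i) else singleton_game (Inl i))"
  using assms(3,4)
proof (induction xs)
  case Nil
  show ?case by (simp add: owen_tensor_singleton_games[OF G0])
next
  case (Cons i xs)
  let ?H = "\<lambda>xs k. if k \<in> set xs then relabel Inr (G k) else singleton_game (Inl k)"
  have H: "(?H xs)(i := relabel Inr (G i)) = ?H (i # xs)" by auto
  have "partial_comp (owen_tensor G0 (?H xs)) (Inl i) (relabel Inr (G i)) =
      owen_tensor G0 ((?H xs)(i := relabel Inr (G i)))"
  proof (rule partial_comp_owen_tensor)
    show "player_order (?H xs k) \<subseteq> players (?H xs k) \<times> players (?H xs k)" if "k \<in> players G0" for k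
      using is_game_order(1)[of "G k"] G[OF that] by (auto simp: relabel_def)
    show "normalized (relabel Inr (G i) :: (_ + _) game)"
      using G[of i] Cons.prems by (simp add: normalized_relabel)
  qed (use Cons.prems G0 is_game_order(1)[OF G0] in \<open>auto simp: is_game_def relabel_def\<close>)
  with Cons show ?case by (simp only: H) simp
qed

text \<open>
  After all players have been replaced every block is a tagged \<open>\<Gamma> i\<close>, and removing the tags
  commutes with the tensor composition.
\<close>

theorem theorem2:
  fixes n :: nat
    and \<Gamma>\<^sub>0 :: "nat game"
    and \<Gamma> :: "nat \<Rightarrow> 'a game"
  assumes "is_game \<Gamma>\<^sub>0" and "nonnegative \<Gamma>\<^sub>0"
    and "players \<Gamma>\<^sub>0 = {1..n}"
    and "player_order \<Gamma>\<^sub>0 = {(i, j). i \<in> {1..n} \<and> j \<in> {1..n} \<and> i \<le> j}"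
    and "\<And>i. i \<in> {1..n} \<Longrightarrow> is_game (\<Gamma> i)"
    and "\<And>i. i \<in> {1..n} \<Longrightarrow> normalized (\<Gamma> i)"
    and "\<And>i. i \<in> {1..n} \<Longrightarrow> nonnegative (\<Gamma> i)"
    and "disjoint_family_on (\<lambda>i. players (\<Gamma> i)) {1..n}"
  shows "owen_tensor \<Gamma>\<^sub>0 \<Gamma> = total_comp n \<Gamma>\<^sub>0 \<Gamma>"
proof -
  let ?H = "\<lambda>i. if i \<in> set [1..<Suc n] then relabel Inr (\<Gamma> i) else singleton_game (Inl i)"
  have "total_comp n \<Gamma>\<^sub>0 \<Gamma> = relabel projr (owen_tensor \<Gamma>\<^sub>0 ?H)"
    unfolding total_comp_def
    by (subst foldr_partial_comp) (use assms in auto)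
  also have "\<dots> = owen_tensor \<Gamma>\<^sub>0 (\<lambda>i. relabel projr (?H i))"
    by (rule relabel_owen_tensor)
  also have "\<dots> = owen_tensor \<Gamma>\<^sub>0 \<Gamma>"
  proof -
    have "relabel projr (?H i) = \<Gamma> i" if "i \<in> players \<Gamma>\<^sub>0" for i
    proof -
      have "projr \<circ> (Inr :: 'a \<Rightarrow> nat + 'a) = id" by auto
      then show ?thesis
        using that assms(3,5) by (auto simp: relabel_relabel relabel_id)
    qed
    then show ?thesis
      by (rule owen_tensor_cong[OF is_game_order(1)[OF assms(1)]])
  qed
  finally show ?thesis by simp
qed

end
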